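(* Let $n\ge 4$ be even, $a,b$ odd with $0<a<b<n$, and $X=\mathcal{M}_O(n,a,b)$. Suppose $\gcd(b-a,n)=2$ and $a\neq n-b$ (so the edges within $V$ form an $n$-cycle). Then $\mathrm{Aut}(X)$ contains a subgroup $G$ acting regularly on $V(X)$ that preserves the partition of $E(X)$ into the $n$-cycle on $U$, the $n$-cycle on $V$, and the perfect matching $\{[u_i,v_i]\}$ (i.e. each element of $G$ maps each of these three parts onto one of the three parts) if and only if $(b-a)^2/2\equiv 2\pmod n$ and at least one of $a+(a-1)(a-b)/2\equiv 1\pmod n$ or $b+(b-1)(b-a)/2\equiv 1\pmod n$ holds.
   Context: $\mathcal{M}_O(n,a,b)$ has vertices $u_0,\dots,u_{n-1},v_0,\dots,v_{n-1}$ and edges $[u_i,u_{i+1}]$ and $[u_i,v_i]$ for all $i$, and $[v_i,v_{i+a}]$, $[v_i,v_{i+b}]$ for all even $i$, subscripts modulo $n$; $U=\{u_i\}$, $V=\{v_i\}$. *)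

theory Defs
  imports "HOL-Algebra.Group_Action" "HOL-Number_Theory.Cong"
begin

(* Graphs are given by a vertex set VS and a set ES of two-element vertex sets.
   Elements of Bij VS are extensional (undefined outside VS), so an automorphism is
   determined by its action on VS and the unit of the group is the identity restricted to VS. *)

definition graph_automorphisms :: "'v set \<Rightarrow> 'v set set \<Rightarrow> ('v \<Rightarrow> 'v) set" where
  "graph_automorphisms VS ES =
     {f \<in> Bij VS. \<forall>x\<in>VS. \<forall>y\<in>VS. {f x, f y} \<in> ES \<longleftrightarrow> {x, y} \<in> ES}"

definition Aut :: "'v set \<Rightarrow> 'v set set \<Rightarrow> ('v \<Rightarrow> 'v) monoid" where
  "Aut VS ES = (BijGroup VS)\<lparr>carrier := graph_automorphisms VS ES\<rparr>"

lemma subgroup_graph_automorphisms: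
  "subgroup (graph_automorphisms VS ES) (BijGroup VS)"
proof (rule group.subgroupI[OF group_BijGroup])
  show "graph_automorphisms VS ES \<subseteq> carrier (BijGroup VS)"
    by (auto simp: graph_automorphisms_def BijGroup_def)
  show "graph_automorphisms VS ES \<noteq> {}"
    using id_Bij[of VS] by (auto simp: graph_automorphisms_def)
next
  fix f assume f: "f \<in> graph_automorphisms VS ES"
  then have fB: "f \<in> Bij VS" and bij: "bij_betw f VS VS"
    by (auto simp: graph_automorphisms_def Bij_def)
  let ?g = "restrict (inv_into VS f) VS"
  have "{?g x, ?g y} \<in> ES \<longleftrightarrow> {x, y} \<in> ES" if "x \<in> VS" "y \<in> VS" for x y
  proof -
    have "inv_into VS f x \<in> VS" "inv_into VS f y \<in> VS"
      "f (inv_into VS f x) = x" "f (inv_into VS f y) = y"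
      using that bij by (simp_all add: bij_betw_def inv_into_into f_inv_into_f)
    moreover have "{f (inv_into VS f x), f (inv_into VS f y)} \<in> ES \<longleftrightarrow>
        {inv_into VS f x, inv_into VS f y} \<in> ES"
      using f calculation(1,2) unfolding graph_automorphisms_def by blast
    ultimately show ?thesis using that by simp
  qed
  then show "inv\<^bsub>BijGroup VS\<^esub> f \<in> graph_automorphisms VS ES"
    using inv_BijGroup[OF fB] restrict_inv_into_Bij[OF fB]
    unfolding graph_automorphisms_def by simp
next
  fix f g assume "f \<in> graph_automorphisms VS ES" "g \<in> graph_automorphisms VS ES"
  then show "f \<otimes>\<^bsub>BijGroup VS\<^esub> g \<in> graph_automorphisms VS ES"
    using Bij_imp_funcset[of g VS]
    by (auto simp: graph_automorphisms_def BijGroup_def compose_Bij compose_eq Pi_iff)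
qed

lemma group_Aut: "group (Aut VS ES)"
  unfolding Aut_def
  by (rule subgroup.subgroup_is_group[OF subgroup_graph_automorphisms group_BijGroup])

definition regular_action :: "('g, 'm) monoid_scheme \<Rightarrow> 'v set \<Rightarrow> ('g \<Rightarrow> 'v \<Rightarrow> 'v) \<Rightarrow> bool" where
  "regular_action H S \<phi> \<longleftrightarrow>
     transitive_action H S \<phi> \<and> (\<forall>x\<in>S. stabilizer H \<phi> x = {\<one>\<^bsub>H\<^esub>})"

(* The image of an edge e under f is f ` e, so the image of a set P of edges is (`) f ` P. *)

definition preserves_edge_partition :: "('v \<Rightarrow> 'v) set \<Rightarrow> 'v set set set \<Rightarrow> bool" where
  "preserves_edge_partition G \<P> \<longleftrightarrow> (\<forall>f\<in>G. \<forall>P\<in>\<P>. (`) f ` P \<in> \<P>)"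

datatype MO_vertex = U nat | V nat

definition MO_verts :: "nat \<Rightarrow> MO_vertex set" where
  "MO_verts n = U ` {..<n} \<union> V ` {..<n}"

definition MO_U_edges :: "nat \<Rightarrow> MO_vertex set set" where
  "MO_U_edges n = {{U i, U ((i + 1) mod n)} | i. i < n}"

definition MO_spokes :: "nat \<Rightarrow> MO_vertex set set" where
  "MO_spokes n = {{U i, V i} | i. i < n}"

definition MO_V_edges :: "nat \<Rightarrow> nat \<Rightarrow> nat \<Rightarrow> MO_vertex set set" where
  "MO_V_edges n a b =
     {{V i, V ((i + a) mod n)} | i. i < n \<and> even i} \<union>
     {{V i, V ((i + b) mod n)} | i. i < n \<and> even i}"

definition MO_edges :: "nat \<Rightarrow> nat \<Rightarrow> nat \<Rightarrow> MO_vertex set set" where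
  "MO_edges n a b = MO_U_edges n \<union> MO_V_edges n a b \<union> MO_spokes n"

end

theory Submission
  imports Defs
begin

text \<open>The spokes are the only perfect matching among the three parts, so an automorphism permuting the
  parts either preserves or exchanges the two cycles. If it fixes a vertex, it acts on the cycle
  on \<open>U\<close> as the identity or as \<open>u\<^sub>i \<mapsto> u\<^bsub>2k-i\<^esub>\<close>; the latter would force \<open>a + b\<close> or both \<open>2a\<close> and \<open>2b\<close>
  to vanish modulo \<open>n\<close>. Hence the group of all these automorphisms is semiregular. Since the
  reflections \<open>i \<mapsto> c - i\<close> with \<open>c\<close> odd make it transitive on \<open>U\<close> and on \<open>V\<close>, a regular group exists
  exactly if some element takes \<open>u\<^sub>0\<close> to \<open>v\<^sub>0\<close>. By semiregularity such an element is an involution.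
  It carries the cycle on \<open>U\<close> to the cycle on \<open>V\<close> in one of the two directions, which
  determines it, and being an involution amounts to the stated congruences.\<close>

section \<open>Automorphisms permuting a family of edge sets\<close>

text \<open>Requiring the family as a whole to be mapped onto itself, rather than each part into the
  family, makes closure under inverses a formal computation.\<close>

definition partition_automorphisms :: "'v set \<Rightarrow> 'v set set \<Rightarrow> 'v set set set \<Rightarrow> ('v \<Rightarrow> 'v) set" where
  "partition_automorphisms VS ES \<P> =
     {f \<in> graph_automorphisms VS ES. (\<lambda>P. (`) f ` P) ` \<P> = \<P>}"

lemma partition_automorphisms_subset:
  "partition_automorphisms VS ES \<P> \<subseteq> graph_automorphisms VS ES"
  by (auto simp: partition_automorphisms_def)

lemma partition_automorphisms_image:
  "f \<in> partition_automorphisms VS ES \<P> \<Longrightarrow> P \<in> \<P> \<Longrightarrow> (`) f ` P \<in> \<P>"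
  using imageI[of P \<P> "\<lambda>P. (`) f ` P"] by (simp add: partition_automorphisms_def)

text \<open>Products in \<open>BijGroup VS\<close> are known as compositions only on
  \<open>VS\<close>, hence the restriction to edges inside \<open>VS\<close>.\<close>

lemma image_edges_compose:
  assumes "P \<subseteq> Pow VS" and "\<And>x. x \<in> VS \<Longrightarrow> h x = f (g x)"
  shows "(`) h ` P = (`) f ` ((`) g ` P)"
proof -
  have "h ` e = f ` (g ` e)" if "e \<in> P" for e
    using that assms by (force simp: image_image)
  then show ?thesis by (simp add: image_image)
qed

lemma image_edges_id:
  assumes "P \<subseteq> Pow VS" and "\<And>x. x \<in> VS \<Longrightarrow> h x = x"
  shows "(`) h ` P = P"
  using image_edges_compose[of P VS h "\<lambda>x. x" "\<lambda>x. x"] assms by simp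

lemma subgroup_partition_automorphisms:
  assumes sub: "\<And>P. P \<in> \<P> \<Longrightarrow> P \<subseteq> Pow VS"
  shows "subgroup (partition_automorphisms VS ES \<P>) (Aut VS ES)"
proof -
  let ?A = "Aut VS ES" and ?S = "partition_automorphisms VS ES \<P>"
  interpret A: group ?A by (rule group_Aut)
  have carr: "carrier ?A = graph_automorphisms VS ES" by (simp add: Aut_def)
  have mult: "(f \<otimes>\<^bsub>?A\<^esub> g) x = f (g x)"
    if "f \<in> carrier ?A" "g \<in> carrier ?A" "x \<in> VS" for f g x
    using that by (auto simp: Aut_def BijGroup_def graph_automorphisms_def compose_eq)
  have one: "\<one>\<^bsub>?A\<^esub> x = x" if "x \<in> VS" for x
    using that by (simp add: Aut_def BijGroup_def)
  have comp: "(\<lambda>P. (`) (f \<otimes>\<^bsub>?A\<^esub> g) ` P) ` \<P> = (\<lambda>P. (`) f ` P) ` ((\<lambda>P. (`) g ` P) ` \<P>)"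
    if "f \<in> carrier ?A" "g \<in> carrier ?A" for f g
    unfolding image_image[of "\<lambda>P. (`) f ` P"]
    by (intro image_cong refl image_edges_compose[OF sub]) (auto simp: mult that)
  show ?thesis
  proof (rule A.subgroupI)
    show "?S \<subseteq> carrier ?A"
      by (auto simp: partition_automorphisms_def carr)
    have "(\<lambda>P. (`) \<one>\<^bsub>?A\<^esub> ` P) ` \<P> = (\<lambda>P. P) ` \<P>"
      by (intro image_cong refl image_edges_id[OF sub]) (auto simp: one)
    then show "?S \<noteq> {}"
      using A.one_closed unfolding partition_automorphisms_def carr by auto
  next
    fix f assume f: "f \<in> ?S"
    then have fc: "f \<in> carrier ?A" and fP: "(\<lambda>P. (`) f ` P) ` \<P> = \<P>"
      by (auto simp: partition_automorphisms_def carr)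
    let ?g = "inv\<^bsub>?A\<^esub> f"
    have gc: "?g \<in> carrier ?A" using fc by simp
    \<comment> \<open>Since \<open>f\<close> permutes the family, the family may be replaced by its
      image under \<open>f\<close>, where the inverse cancels.\<close>
    have "(\<lambda>P. (`) ?g ` P) ` \<P> = (\<lambda>P. (`) (?g \<otimes>\<^bsub>?A\<^esub> f) ` P) ` \<P>"
      unfolding comp[OF gc fc] fP ..
    also have "\<dots> = (\<lambda>P. P) ` \<P>"
      by (intro image_cong refl image_edges_id[OF sub]) (auto simp: one fc)
    finally show "?g \<in> ?S"
      using gc by (simp add: partition_automorphisms_def carr)
    fix g assume g: "g \<in> ?S"
    then have gc: "g \<in> carrier ?A" and gP: "(\<lambda>P. (`) g ` P) ` \<P> = \<P>"
      by (auto simp: partition_automorphisms_def carr)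
    show "f \<otimes>\<^bsub>?A\<^esub> g \<in> ?S"
      using A.m_closed[OF fc gc] comp[OF fc gc] fP gP
      by (simp add: partition_automorphisms_def carr)
  qed
qed

text \<open>For an involution one inclusion is enough: applying \<open>f\<close> twice turns "edges
  of \<open>P\<close> go into \<open>\<sigma> P\<close>" into equality, and it also shows that
  non-edges go to non-edges.\<close>

lemma involution_in_partition_automorphisms:
  assumes sub: "\<And>P. P \<in> \<P> \<Longrightarrow> P \<subseteq> Pow VS" and ES: "ES = \<Union>\<P>"
    and ext: "f \<in> extensional VS"
    and inv: "\<And>x. x \<in> VS \<Longrightarrow> f x \<in> VS" "\<And>x. x \<in> VS \<Longrightarrow> f (f x) = x"
    and \<sigma>: "\<And>P. P \<in> \<P> \<Longrightarrow> \<sigma> P \<in> \<P>" "\<And>P. P \<in> \<P> \<Longrightarrow> \<sigma> (\<sigma> P) = P"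
    and maps: "\<And>P e. P \<in> \<P> \<Longrightarrow> e \<in> P \<Longrightarrow> f ` e \<in> \<sigma> P"
  shows "f \<in> partition_automorphisms VS ES \<P>"
proof -
  have "bij_betw f VS VS"
    by (rule bij_betw_byWitness[where f'=f]) (use inv in auto)
  moreover have ed: "{f x, f y} \<in> ES" if "{x, y} \<in> ES" for x y
  proof -
    obtain P where "P \<in> \<P>" "{x, y} \<in> P" using \<open>{x, y} \<in> ES\<close> unfolding ES by blast
    then have "f ` {x, y} \<in> ES" using maps \<sigma>(1) unfolding ES by blast
    then show ?thesis by simp
  qed
  have "{f x, f y} \<in> ES \<longleftrightarrow> {x, y} \<in> ES" if "x \<in> VS" "y \<in> VS" for x y
    using ed[of x y] ed[of "f x" "f y"] inv(2) that by auto
  ultimately have aut: "f \<in> graph_automorphisms VS ES"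
    using ext by (auto simp: graph_automorphisms_def Bij_def)
  have img: "(`) f ` P = \<sigma> P" if P: "P \<in> \<P>" for P
  proof
    show "(`) f ` P \<subseteq> \<sigma> P" using maps[OF P] by auto
    have "\<sigma> P = (`) f ` ((`) f ` \<sigma> P)"
      using image_edges_compose[of "\<sigma> P" VS "\<lambda>x. x" f f] sub[OF \<sigma>(1)[OF P]] inv(2) by simp
    also have "\<dots> \<subseteq> (`) f ` P"
      using maps[OF \<sigma>(1)[OF P]] \<sigma>(2)[OF P] by (intro image_mono) auto
    finally show "\<sigma> P \<subseteq> (`) f ` P" .
  qed
  have "\<sigma> ` \<P> = \<P>"
  proof
    show "\<P> \<subseteq> \<sigma> ` \<P>"
    proof
      fix P assume "P \<in> \<P>"
      then show "P \<in> \<sigma> ` \<P>" using \<sigma>[of P] imageI[of "\<sigma> P" \<P> \<sigma>] by simp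
    qed
  qed (use \<sigma>(1) in blast)
  then show ?thesis
    using aut img by (simp add: partition_automorphisms_def)
qed

section \<open>Regularity and the group operations in terms of points\<close>

lemma regular_action_iff:
  assumes G: "subgroup G (Aut VS ES)"
  shows "regular_action ((Aut VS ES)\<lparr>carrier := G\<rparr>) VS (\<lambda>f. f) \<longleftrightarrow>
    (\<forall>x\<in>VS. \<forall>y\<in>VS. \<exists>g\<in>G. g x = y) \<and> (\<forall>x\<in>VS. \<forall>g\<in>G. g x = x \<longrightarrow> g = (\<lambda>x\<in>VS. x))"
proof -
  let ?H = "(Aut VS ES)\<lparr>carrier := G\<rparr>"
  have sub: "G \<subseteq> graph_automorphisms VS ES"
    using subgroup.subset[OF G] by (simp add: Aut_def)
  have "group_hom ?H (BijGroup VS) (\<lambda>f. f)"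
    using subgroup.subgroup_is_group[OF G group_Aut] group_BijGroup sub
    by (auto simp: group_hom_def group_hom_axioms_def hom_def Aut_def BijGroup_def
        graph_automorphisms_def)
  then have "group_action ?H VS (\<lambda>f. f)" by (rule group_action.intro)
  then have "transitive_action ?H VS (\<lambda>f. f) \<longleftrightarrow> (\<forall>x\<in>VS. \<forall>y\<in>VS. \<exists>g\<in>G. g x = y)"
    by (simp add: transitive_action_def transitive_action_axioms_def) blast
  moreover have one: "\<one>\<^bsub>?H\<^esub> = (\<lambda>x\<in>VS. x)"
    by (simp add: Aut_def BijGroup_def)
  have "(\<lambda>x\<in>VS. x) \<in> G"
    using subgroup.one_closed[OF G] by (simp add: Aut_def BijGroup_def)
  then have "stabilizer ?H (\<lambda>f. f) x = {\<one>\<^bsub>?H\<^esub>} \<longleftrightarrow> (\<forall>g\<in>G. g x = x \<longrightarrow> g = (\<lambda>x\<in>VS. x))"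
    if "x \<in> VS" for x
    using that unfolding stabilizer_def one by auto
  ultimately show ?thesis by (simp add: regular_action_def)
qed

text \<open>Hands out the product by its values on \<open>VS\<close> only, so that later arguments
  need not unfold the group structure.\<close>

lemma subgroup_Aut_mult_closed:
  assumes "subgroup G (Aut VS ES)" and "f \<in> G" and "g \<in> G"
  obtains h where "h \<in> G" and "\<And>x. x \<in> VS \<Longrightarrow> h x = f (g x)"
proof
  have "f \<in> Bij VS" "g \<in> Bij VS"
    using assms subgroup.subset[OF assms(1)] by (auto simp: Aut_def graph_automorphisms_def)
  then show "\<And>x. x \<in> VS \<Longrightarrow> (f \<otimes>\<^bsub>Aut VS ES\<^esub> g) x = f (g x)"
    by (simp add: Aut_def BijGroup_def compose_eq)
qed (rule subgroup.m_closed[OF assms])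

lemma subgroup_Aut_inv_closed:
  assumes "subgroup G (Aut VS ES)" and "f \<in> G"
  obtains h where "h \<in> G" and "\<And>x. x \<in> VS \<Longrightarrow> h (f x) = x"
proof
  let ?A = "Aut VS ES"
  interpret A: group ?A by (rule group_Aut)
  show gG: "inv\<^bsub>?A\<^esub> f \<in> G"
    using subgroup.m_inv_closed[OF assms] .
  have "f \<in> carrier ?A" using assms subgroup.subset by blast
  then have eq: "inv\<^bsub>?A\<^esub> f \<otimes>\<^bsub>?A\<^esub> f = \<one>\<^bsub>?A\<^esub>" by simp
  have "f \<in> Bij VS" "inv\<^bsub>?A\<^esub> f \<in> Bij VS"
    using assms(2) gG subgroup.subset[OF assms(1)] by (auto simp: Aut_def graph_automorphisms_def)
  then show "(inv\<^bsub>?A\<^esub> f) (f x) = x" if "x \<in> VS" for x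
    using fun_cong[OF eq, of x] that by (simp add: Aut_def BijGroup_def compose_eq)
qed

text \<open>Here \<open>c\<close> is the periodic numbering of a cycle. The first step chooses a
  direction, and a walk that never turns back must keep it.\<close>

lemma nonbacktracking_walk:
  fixes c :: "int \<Rightarrow> 'v" and p :: "nat \<Rightarrow> 'v"
  assumes nbr: "\<And>j x. {c j, x} \<in> E \<Longrightarrow> x = c (j + 1) \<or> x = c (j - 1)"
    and walk: "\<And>i. {p i, p (Suc i)} \<in> E" and nb: "\<And>i. p i \<noteq> p (Suc (Suc i))"
    and start: "p 0 = c k"
  shows "(\<forall>i. p i = c (k + int i)) \<or> (\<forall>i. p i = c (k - int i))"
proof -
  have "p 1 = c (k + 1) \<or> p 1 = c (k - 1)"
    using nbr[of k "p 1"] walk[of 0] start by simp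
  then obtain s :: int where s: "s = 1 \<or> s = - 1" and p1: "p 1 = c (k + s)"
    by force
  \<comment> \<open>Two consecutive positions are carried along, because the next one is determined
    by excluding the previous one.\<close>
  have "p i = c (k + s * int i) \<and> p (Suc i) = c (k + s * int (Suc i))" for i
  proof (induction i)
    case 0 then show ?case using start p1 by simp
  next
    case (Suc i)
    let ?j = "k + s * int (Suc i)"
    have "p (Suc (Suc i)) = c (?j + 1) \<or> p (Suc (Suc i)) = c (?j - 1)"
      using nbr[of ?j] walk[of "Suc i"] Suc by simp
    then have "p (Suc (Suc i)) = c (?j + s) \<or> p (Suc (Suc i)) = c (?j - s)"
      using s by auto
    moreover have "?j - s = k + s * int i" "?j + s = k + s * int (Suc (Suc i))"
      by (simp_all add: algebra_simps)
    ultimately show ?case using nb[of i] Suc by metis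
  qed
  then show ?thesis using s by auto
qed

section \<open>The numbering of the second cycle\<close>

text \<open>Starting from \<open>v\<^sub>0\<close>, the cycle on \<open>V\<close> alternately adds \<open>b\<close> and subtracts \<open>a\<close>;
  its \<open>i\<close>-th vertex has subscript \<open>zigzag a b i\<close>.\<close>

definition zigzag :: "int \<Rightarrow> int \<Rightarrow> int \<Rightarrow> int" where
  "zigzag a b i = i div 2 * (b - a) + (if odd i then b else 0)"

lemma zigzag_double [simp]: "zigzag a b (2 * k) = k * (b - a)"
  and zigzag_double_plus_1 [simp]: "zigzag a b (2 * k + 1) = k * (b - a) + b"
  by (simp_all add: zigzag_def)

lemma zigzag_0 [simp]: "zigzag a b 0 = 0"
  by (simp add: zigzag_def)

text \<open>Walking the cycle backwards, the first step adds \<open>a\<close> instead of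
  \<open>b\<close>, so the two parameters change roles. This is the source of the two alternatives
  in the theorem.\<close>

lemma zigzag_minus: "zigzag a b (- i) = zigzag b a i"
proof (cases "even i")
  case True
  then obtain k where "i = 2 * k" by blast
  then have "- i = 2 * (- k)" by simp
  then show ?thesis using \<open>i = 2 * k\<close> by (simp only: zigzag_double) (simp add: algebra_simps)
next
  case False
  then obtain k where "i = 2 * k + 1" by (blast elim: oddE)
  then have "- i = 2 * (- k - 1) + 1" by simp
  then show ?thesis using \<open>i = 2 * k + 1\<close>
    by (simp only: zigzag_double_plus_1) (simp add: algebra_simps)
qed

lemma zigzag_next_even:
  assumes "even j"
  shows "zigzag a b (j + 1) = zigzag a b j + b" and "zigzag a b (j - 1) = zigzag a b j + a"
proof -
  obtain k where k: "j = 2 * k" using assms by blast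
  then show "zigzag a b (j + 1) = zigzag a b j + b" by (simp only: zigzag_double zigzag_double_plus_1)
  have "j - 1 = 2 * (k - 1) + 1" using k by simp
  then show "zigzag a b (j - 1) = zigzag a b j + a"
    by (simp only: k zigzag_double zigzag_double_plus_1) (simp add: algebra_simps)
qed

lemma zigzag_next_odd:
  assumes "odd j"
  shows "zigzag a b (j + 1) = zigzag a b j - a" and "zigzag a b (j - 1) = zigzag a b j - b"
  using zigzag_next_even(2)[of "j + 1" a b] zigzag_next_even(1)[of "j - 1" a b] assms by simp_all

lemma even_zigzag: "odd a \<Longrightarrow> odd b \<Longrightarrow> even (zigzag a b i) \<longleftrightarrow> even i"
  by (auto simp: zigzag_def)

text \<open>With \<open>b - a = 2 * e\<close> and \<open>b = 2 * h + 1\<close> the inner values are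
  \<open>2 * (k * e)\<close> and \<open>2 * (k * e + h) + 1\<close>, so the outer
  \<open>zigzag\<close> can be evaluated by parity.\<close>

lemma zigzag_zigzag:
  fixes a b :: int
  assumes "odd a" "odd b"
  shows "zigzag a b (zigzag a b (2 * k)) = k * ((b - a)^2 div 2)"
    and "zigzag a b (zigzag a b (2 * k + 1)) = k * ((b - a)^2 div 2) + (b + (b - 1) * (b - a) div 2)"
proof -
  from assms have "even (b - a)" by simp
  then obtain e where e: "b - a = 2 * e" by blast
  from assms obtain h where h: "b = 2 * h + 1" by (blast elim: oddE)
  have 1: "(b - a)^2 div 2 = 2 * e * e" unfolding e by (simp add: power2_eq_square)
  have 2: "(b - 1) * (b - a) div 2 = 2 * h * e" unfolding e by (simp add: h)
  have "zigzag a b (2 * k) = 2 * (k * e)" by (simp add: e)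
  then show "zigzag a b (zigzag a b (2 * k)) = k * ((b - a)^2 div 2)"
    by (simp only: zigzag_double 1) (simp add: e)
  have "zigzag a b (2 * k + 1) = 2 * (k * e + h) + 1"
    unfolding zigzag_double_plus_1 e by (simp add: h)
  then show "zigzag a b (zigzag a b (2 * k + 1)) = k * ((b - a)^2 div 2) + (b + (b - 1) * (b - a) div 2)"
    by (simp only: zigzag_double_plus_1 1 2 e) (simp add: algebra_simps power2_eq_square)
qed

text \<open>On each parity class the double zigzag is affine in \<open>k\<close>. Comparing slope
  and constant term with \<open>2 * k\<close> and \<open>2 * k + 1\<close> leaves two
  congruences.\<close>

lemma zigzag_involution_iff:
  fixes a b m :: int
  assumes "odd a" "odd b"
  shows "(\<forall>i. m dvd zigzag a b (zigzag a b i) - i) \<longleftrightarrow>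
    [(b - a)^2 div 2 = 2] (mod m) \<and> [b + (b - 1) * (b - a) div 2 = 1] (mod m)"
proof
  assume *: "\<forall>i. m dvd zigzag a b (zigzag a b i) - i"
  show "[(b - a)^2 div 2 = 2] (mod m) \<and> [b + (b - 1) * (b - a) div 2 = 1] (mod m)"
    \<comment> \<open>The positions 2 and 1 suffice; they are written so that the closed forms for
      even and odd positions apply.\<close>
    using *[rule_format, of "2 * 1"] *[rule_format, of "2 * 0 + 1"]
    unfolding zigzag_zigzag[OF assms] by (simp add: cong_iff_dvd_diff)
next
  assume *: "[(b - a)^2 div 2 = 2] (mod m) \<and> [b + (b - 1) * (b - a) div 2 = 1] (mod m)"
  show "\<forall>i. m dvd zigzag a b (zigzag a b i) - i"
  proof
    fix i
    have k: "[k * ((b - a)^2 div 2) = 2 * k] (mod m)" for k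
      using cong_mult[OF cong_refl[of k m] conjunct1[OF *]] by (simp add: mult.commute)
    show "m dvd zigzag a b (zigzag a b i) - i"
    proof (cases "even i")
      case True
      then obtain k where "i = 2 * k" by blast
      then show ?thesis
        using k[of k] zigzag_zigzag(1)[OF assms, of k] by (simp only: cong_iff_dvd_diff)
    next
      case False
      then obtain k where "i = 2 * k + 1" by (blast elim: oddE)
      then show ?thesis
        using cong_add[OF k[of k] conjunct2[OF *]] zigzag_zigzag(2)[OF assms, of k]
        by (simp only: cong_iff_dvd_diff)
    qed
  qed
qed

text \<open>Shifting the position by \<open>m * t\<close> with \<open>m = 2 * s\<close> adds
  \<open>s * t\<close> to the half \<open>i div 2\<close>. As \<open>b - a\<close> is even, the
  value changes by a multiple of \<open>m\<close>.\<close>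

lemma zigzag_cong:
  fixes a b m :: int
  assumes "even m" "odd a" "odd b" "m dvd i - j"
  shows "m dvd zigzag a b i - zigzag a b j"
proof -
  obtain s t where s: "m = 2 * s" and t: "i - j = m * t"
    using assms by blast
  from assms(2,3) have "even (b - a)" by simp
  then obtain e where e: "b - a = 2 * e" by blast
  have i: "i = j + 2 * (s * t)" using s t by simp
  have "i div 2 = j div 2 + s * t" "odd i \<longleftrightarrow> odd j" unfolding i by simp_all
  then have "zigzag a b i - zigzag a b j = m * (t * e)"
    unfolding zigzag_def e s by (simp add: algebra_simps)
  then show ?thesis by simp
qed

section \<open>The graphs with integer subscripts\<close>

text \<open>The conditions are symmetric in \<open>a\<close> and \<open>b\<close>, so the parameters
  can be exchanged. \<open>diff_ndvd\<close> makes the two neighbours of a vertex within V distinct;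
  \<open>sum_ndvd\<close> rules out reflections that fix a vertex.\<close>

locale honeycomb =
  fixes n a b :: nat
  assumes n4: "n \<ge> 4" and even_n: "even n" and odd_a: "odd a" and odd_b: "odd b"
    and diff_ndvd: "\<not> int n dvd int a - int b" and sum_ndvd: "\<not> int n dvd int a + int b"
begin

text \<open>Integer subscripts read modulo \<open>n\<close>: subtraction is total, and equality of
  vertices becomes a divisibility.\<close>

definition uu :: "int \<Rightarrow> MO_vertex" where "uu i = U (nat (i mod int n))"
definition vv :: "int \<Rightarrow> MO_vertex" where "vv i = V (nat (i mod int n))"

lemma swap_params: "honeycomb n b a"
  using n4 even_n odd_a odd_b diff_ndvd sum_ndvd
  by unfold_locales (auto simp: add.commute dvd_diff_commute)

lemma n_pos: "int n > 0" using n4 by simp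

lemma uu_eq_iff [simp]: "uu i = uu j \<longleftrightarrow> int n dvd i - j"
  using n_pos by (simp add: uu_def nat_eq_iff pos_mod_sign mod_eq_dvd_iff)

lemma vv_eq_iff [simp]: "vv i = vv j \<longleftrightarrow> int n dvd i - j"
  using n_pos by (simp add: vv_def nat_eq_iff pos_mod_sign mod_eq_dvd_iff)

lemma uu_neq_vv [simp]: "uu i \<noteq> vv j" "vv i \<noteq> uu j"
  by (simp_all add: uu_def vv_def)

lemma even_iff_if_dvd: "int n dvd i - j \<Longrightarrow> even i \<longleftrightarrow> even j"
  using even_n dvd_trans[of 2 "int n" "i - j"] by simp

lemma small_ndvd: "\<not> int n dvd 1" "\<not> int n dvd 2" "\<not> int n dvd - 1" "\<not> int n dvd - 2"
  using n4 zdvd_imp_le[of "int n" 2] by auto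

lemma uu_nat: "i < n \<Longrightarrow> uu (int i) = U i" and vv_nat: "i < n \<Longrightarrow> vv (int i) = V i"
  by (simp_all add: uu_def vv_def)

lemma nat_mod_less: "nat (i mod int n) < n"
  using n_pos by (simp add: nat_less_iff)

lemma verts_eq: "MO_verts n = range uu \<union> range vv"
proof -
  have "range uu = U ` {..<n}" "range vv = V ` {..<n}"
    using nat_mod_less
    by (auto simp: uu_def[symmetric] vv_def[symmetric] uu_nat[symmetric] vv_nat[symmetric] simp del: uu_eq_iff vv_eq_iff)
       (simp_all add: uu_def vv_def)
  then show ?thesis by (simp add: MO_verts_def)
qed

lemma uu_in_verts [simp]: "uu i \<in> MO_verts n" and vv_in_verts [simp]: "vv i \<in> MO_verts n"
  unfolding verts_eq by blast+

lemma verts_cases: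
  assumes "x \<in> MO_verts n"
  obtains i where "x = uu i" | i where "x = vv i"
  using assms unfolding verts_eq by blast

lemma uu_mod: "uu (int (nat (i mod int n)) + k) = uu (i + k)"
  and vv_mod: "vv (int (nat (i mod int n)) + k) = vv (i + k)"
  using n_pos by (simp_all add: uu_def vv_def mod_simps)

lemma even_mod: "even (nat (i mod int n)) \<longleftrightarrow> even i"
proof -
  have "even (i mod int n) \<longleftrightarrow> even i"
    using even_n by (simp add: dvd_mod_iff)
  then show ?thesis using n_pos by (simp add: even_nat_iff)
qed

lemma U_nat_mod: "U (i mod n) = uu (int i)" and V_nat_mod: "V (i mod n) = vv (int i)"
  by (simp_all add: uu_def vv_def nat_mod_distrib)

lemma U_edges_eq: "MO_U_edges n = {{uu i, uu (i + 1)} | i. True}"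
proof (intro equalityI subsetI)
  fix e assume "e \<in> MO_U_edges n"
  then obtain i where "i < n" "e = {U i, U ((i + 1) mod n)}"
    by (auto simp: MO_U_edges_def)
  then have "e = {uu (int i), uu (int i + 1)}"
    unfolding U_nat_mod using uu_nat[of i] by (simp add: add.commute)
  then show "e \<in> {{uu i, uu (i + 1)} | i. True}" by blast
next
  fix e assume "e \<in> {{uu i, uu (i + 1)} | i. True}"
  then obtain i where e: "e = {uu i, uu (i + 1)}" by blast
  let ?k = "nat (i mod int n)"
  have "e = {U ?k, U ((?k + 1) mod n)}"
    unfolding U_nat_mod e using uu_mod[of i 1] by (simp only: uu_def[of i] of_nat_add of_nat_1)
  then show "e \<in> MO_U_edges n"
    using nat_mod_less unfolding MO_U_edges_def by blast
qed

lemma spokes_eq: "MO_spokes n = {{uu i, vv i} | i. True}"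
proof (intro equalityI subsetI)
  fix e assume "e \<in> MO_spokes n"
  then obtain i where "i < n" "e = {U i, V i}"
    by (auto simp: MO_spokes_def)
  then have "e = {uu (int i), vv (int i)}"
    using uu_nat[of i] vv_nat[of i] by simp
  then show "e \<in> {{uu i, vv i} | i. True}" by blast
next
  fix e assume "e \<in> {{uu i, vv i} | i. True}"
  then show "e \<in> MO_spokes n"
    using nat_mod_less unfolding MO_spokes_def uu_def vv_def by blast
qed

lemma V_edges_eq:
  "MO_V_edges n a b = {{vv i, vv (i + int a)} | i. even i} \<union> {{vv i, vv (i + int b)} | i. even i}"
proof -
  have "{{V i, V ((i + c) mod n)} | i. i < n \<and> even i} = {{vv i, vv (i + int c)} | i. even i}"
    for c
  proof (intro equalityI subsetI)
    fix e assume "e \<in> {{V i, V ((i + c) mod n)} | i. i < n \<and> even i}"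
    then obtain i where i: "i < n" "even i" "e = {V i, V ((i + c) mod n)}"
      by auto
    then have "e = {vv (int i), vv (int i + int c)}" "even (int i)"
      unfolding V_nat_mod using vv_nat[of i] by simp_all
    then show "e \<in> {{vv i, vv (i + int c)} | i. even i}" by blast
  next
    fix e assume "e \<in> {{vv i, vv (i + int c)} | i. even i}"
    then obtain i where e: "e = {vv i, vv (i + int c)}" "even i" by blast
    let ?k = "nat (i mod int n)"
    have "e = {V ?k, V ((?k + c) mod n)}" "even ?k"
      unfolding V_nat_mod e(1) using vv_mod[of i "int c"] e(2)
      by (simp_all only: vv_def[of i] of_nat_add even_mod)
    then show "e \<in> {{V i, V ((i + c) mod n)} | i. i < n \<and> even i}"
      using nat_mod_less by blast
  qed
  then show ?thesis by (simp add: MO_V_edges_def)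
qed

section \<open>Neighbours of a vertex within each part\<close>

lemma U_edge_iff: "{uu i, x} \<in> MO_U_edges n \<longleftrightarrow> x = uu (i + 1) \<or> x = uu (i - 1)"
proof
  assume "{uu i, x} \<in> MO_U_edges n"
  then obtain j where "{uu i, x} = {uu j, uu (j + 1)}" by (auto simp: U_edges_eq)
  then have "(int n dvd i - j \<and> x = uu (j + 1)) \<or> (int n dvd i - (j + 1) \<and> x = uu j)"
    by (metis doubleton_eq_iff uu_eq_iff)
  then show "x = uu (i + 1) \<or> x = uu (i - 1)"
    by (auto simp: dvd_diff_commute algebra_simps)
next
  assume "x = uu (i + 1) \<or> x = uu (i - 1)"
  moreover have "{uu i, uu (i - 1)} = {uu (i - 1), uu (i - 1 + 1)}" by auto
  ultimately show "{uu i, x} \<in> MO_U_edges n" unfolding U_edges_eq by blast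
qed

lemma spoke_iff:
  "{uu i, x} \<in> MO_spokes n \<longleftrightarrow> x = vv i" "{vv i, x} \<in> MO_spokes n \<longleftrightarrow> x = uu i"
  by (auto simp: spokes_eq doubleton_eq_iff dvd_diff_commute intro: exI[of _ i])

text \<open>Edges are given from their even end. Since \<open>a\<close> and \<open>b\<close> are
  odd, the other end is odd, and seen from there the offset is subtracted.\<close>

lemma V_edge_iff:
  "{vv i, x} \<in> MO_V_edges n a b \<longleftrightarrow>
     (if even i then x = vv (i + int a) \<or> x = vv (i + int b)
      else x = vv (i - int a) \<or> x = vv (i - int b))"
proof
  assume "{vv i, x} \<in> MO_V_edges n a b"
  then obtain j c where jc: "even j" "c = int a \<or> c = int b" "{vv i, x} = {vv j, vv (j + c)}"
    by (auto simp: V_edges_eq)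
  have "odd c" using jc(2) odd_a odd_b by auto
  from jc(3) have "(int n dvd i - j \<and> x = vv (j + c)) \<or> (int n dvd i - (j + c) \<and> x = vv j)"
    by (metis doubleton_eq_iff vv_eq_iff)
  then have "(even i \<and> x = vv (i + c)) \<or> (odd i \<and> x = vv (i - c))"
    using even_iff_if_dvd[of i j] even_iff_if_dvd[of i "j + c"] \<open>even j\<close> \<open>odd c\<close>
    by (auto simp: dvd_diff_commute algebra_simps)
  then show "if even i then x = vv (i + int a) \<or> x = vv (i + int b)
      else x = vv (i - int a) \<or> x = vv (i - int b)"
    using jc(2) by auto
next
  assume "if even i then x = vv (i + int a) \<or> x = vv (i + int b)
      else x = vv (i - int a) \<or> x = vv (i - int b)"
  then obtain c where c: "c = int a \<or> c = int b" "x = (if even i then vv (i + c) else vv (i - c))"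
    by (auto split: if_splits)
  have "odd c" using c(1) odd_a odd_b by auto
  show "{vv i, x} \<in> MO_V_edges n a b"
  proof (cases "even i")
    case True then show ?thesis using c unfolding V_edges_eq by auto
  next
    case False
    then have "{vv i, x} = {vv (i - c), vv (i - c + c)}" "even (i - c)"
      using c(2) \<open>odd c\<close> by auto
    then show ?thesis using c(1) unfolding V_edges_eq by blast
  qed
qed

lemma vv_notin_U_edge: "e \<in> MO_U_edges n \<Longrightarrow> vv i \<notin> e"
  by (auto simp: U_edges_eq)

lemma uu_notin_V_edge: "e \<in> MO_V_edges n a b \<Longrightarrow> uu i \<notin> e"
  by (auto simp: V_edges_eq)

abbreviation "parts \<equiv> {MO_U_edges n, MO_V_edges n a b, MO_spokes n}"

lemma edges_eq: "MO_edges n a b = \<Union>parts"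
  by (auto simp: MO_edges_def)

lemma parts_subset: "P \<in> parts \<Longrightarrow> P \<subseteq> Pow (MO_verts n)"
  by (auto simp: U_edges_eq V_edges_eq spokes_eq)

section \<open>Semiregularity\<close>

text \<open>The condition on a single map, shared by the members of an arbitrary group as in the
  theorem and those of the largest such group, so that both directions can use the lemmas
  below.\<close>

definition preserving :: "(MO_vertex \<Rightarrow> MO_vertex) \<Rightarrow> bool" where
  "preserving f \<longleftrightarrow> f \<in> graph_automorphisms (MO_verts n) (MO_edges n a b) \<and>
     (\<forall>P\<in>parts. (`) f ` P \<in> parts)"

lemma preserving_eq_iff:
  "preserving f \<Longrightarrow> x \<in> MO_verts n \<Longrightarrow> y \<in> MO_verts n \<Longrightarrow> f x = f y \<longleftrightarrow> x = y"
  unfolding preserving_def graph_automorphisms_def Bij_def bij_betw_def by (auto dest: inj_onD)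

text \<open>Being a matching is invariant under injective maps, so this property recognises the
  image of the spokes. In the other parts \<open>uu 0\<close> and \<open>vv 0\<close> have two
  distinct neighbours.\<close>

lemma matching_part_iff:
  assumes "P \<in> parts"
  shows "P = MO_spokes n \<longleftrightarrow> (\<forall>x y z. {x, y} \<in> P \<longrightarrow> {x, z} \<in> P \<longrightarrow> y = z)"
proof
  assume P: "P = MO_spokes n"
  show "\<forall>x y z. {x, y} \<in> P \<longrightarrow> {x, z} \<in> P \<longrightarrow> y = z"
  proof (intro allI impI)
    fix x y z assume xy: "{x, y} \<in> P" and xz: "{x, z} \<in> P"
    then have "x \<in> MO_verts n" using parts_subset[of P] P by blast
    then obtain i where "x = uu i \<or> x = vv i" unfolding verts_eq by blast
    then show "y = z" using xy xz unfolding P by (auto simp: spoke_iff)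
  qed
next
  assume *: "\<forall>x y z. {x, y} \<in> P \<longrightarrow> {x, z} \<in> P \<longrightarrow> y = z"
  have "uu (0 + 1) \<noteq> uu (0 - 1)" "vv (0 + int a) \<noteq> vv (0 + int b)"
    using small_ndvd diff_ndvd by simp_all
  then have "P \<noteq> MO_U_edges n" "P \<noteq> MO_V_edges n a b"
    using * U_edge_iff[of 0] V_edge_iff[of 0] by (metis, metis even_zero)
  then show "P = MO_spokes n" using assms by blast
qed

lemma preserving_spokes:
  assumes f: "preserving f"
  shows "(`) f ` MO_spokes n = MO_spokes n"
proof -
  have "y = z" if xy: "{x, y} \<in> (`) f ` MO_spokes n" and xz: "{x, z} \<in> (`) f ` MO_spokes n"
    for x y z
  proof -
    \<comment> \<open>An unordered edge of the image is lifted to a spoke whose ends are named in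
      the order of \<open>x\<close> and \<open>t\<close>.\<close>
    have img: "\<exists>u w. {u, w} \<in> MO_spokes n \<and> {u, w} \<subseteq> MO_verts n \<and> x = f u \<and> t = f w"
      if "{x, t} \<in> (`) f ` MO_spokes n" for t
    proof -
      obtain e where "{x, t} = f ` e" "e \<in> MO_spokes n" using \<open>{x, t} \<in> _\<close> by blast
      then obtain i where i: "{x, t} = {f (uu i), f (vv i)}"
        unfolding spokes_eq by auto
      have "{uu i, vv i} \<in> MO_spokes n" "{vv i, uu i} \<in> MO_spokes n"
        "{uu i, vv i} \<subseteq> MO_verts n" "{vv i, uu i} \<subseteq> MO_verts n"
        by (simp_all add: spoke_iff)
      with i show ?thesis unfolding doubleton_eq_iff by blast
    qed
    obtain u w u' w' where "{u, w} \<in> MO_spokes n" "{u', w'} \<in> MO_spokes n" "x = f u" "x = f u'"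
      "{u, w} \<subseteq> MO_verts n" "{u', w'} \<subseteq> MO_verts n" "y = f w" "z = f w'"
      using img[OF xy] img[OF xz] by blast
    moreover have "u = u'" using preserving_eq_iff[OF f, of u u'] calculation by simp
    ultimately show "y = z" using matching_part_iff[of "MO_spokes n"] by blast
  qed
  moreover have "(`) f ` MO_spokes n \<in> parts" using f by (simp add: preserving_def)
  ultimately show ?thesis using matching_part_iff[of "(`) f ` MO_spokes n"] by presburger
qed

text \<open>The action on V is thus determined by the action on U.\<close>

lemma preserving_spoke:
  assumes "preserving f"
  shows "f (uu i) = uu k \<longleftrightarrow> f (vv i) = vv k" "f (uu i) = vv k \<longleftrightarrow> f (vv i) = uu k"
proof -
  have "{uu i, vv i} \<in> MO_spokes n" by (simp add: spoke_iff)
  then have "f ` {uu i, vv i} \<in> MO_spokes n" using preserving_spokes[OF assms] by blast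
  then have e: "{f (uu i), f (vv i)} \<in> MO_spokes n" "{f (vv i), f (uu i)} \<in> MO_spokes n"
    by (simp_all add: insert_commute)
  show "f (uu i) = uu k \<longleftrightarrow> f (vv i) = vv k" "f (uu i) = vv k \<longleftrightarrow> f (vv i) = uu k"
    using e spoke_iff by metis+
qed

text \<open>Injectivity of \<open>f\<close> would pull the matching property back to
  \<open>P\<close>, but no spoke lies inside U or inside V.\<close>

lemma preserving_part_not_spokes:
  assumes f: "preserving f" and P: "P = MO_U_edges n \<or> P = MO_V_edges n a b"
  shows "(`) f ` P \<noteq> MO_spokes n"
proof
  assume "(`) f ` P = MO_spokes n"
  then have "y = z" if "{x, y} \<in> P" "{x, z} \<in> P" for x y z
  proof -
    have "f ` {x, y} \<in> MO_spokes n" "f ` {x, z} \<in> MO_spokes n"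
      using \<open>(`) f ` P = MO_spokes n\<close> that by blast+
    then have "{f x, f y} \<in> MO_spokes n" "{f x, f z} \<in> MO_spokes n" by simp_all
    then have "f y = f z" using matching_part_iff[of "MO_spokes n"] by blast
    moreover have "y \<in> MO_verts n" "z \<in> MO_verts n" using parts_subset[of P] P that by blast+
    ultimately show "y = z" using preserving_eq_iff[OF f] by blast
  qed
  then have "P = MO_spokes n" using P matching_part_iff[of P] by blast
  moreover have "{uu 0, vv 0} \<in> MO_spokes n" by (simp add: spoke_iff)
  ultimately show False using P vv_notin_U_edge uu_notin_V_edge by blast
qed

text \<open>The two cycles have disjoint vertex sets, so one image vertex decides which of them is
  the image.\<close>

lemma preserving_U_edges:
  assumes f: "preserving f"
  shows "f (uu i) = uu k \<Longrightarrow> (`) f ` MO_U_edges n = MO_U_edges n"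
    and "f (uu i) = vv k \<Longrightarrow> (`) f ` MO_U_edges n = MO_V_edges n a b"
proof -
  have "(`) f ` MO_U_edges n = MO_U_edges n \<or> (`) f ` MO_U_edges n = MO_V_edges n a b"
    using f preserving_part_not_spokes[OF f, of "MO_U_edges n"] by (simp add: preserving_def)
  moreover have "{uu i, uu (i + 1)} \<in> MO_U_edges n" by (simp add: U_edge_iff)
  then have "f ` {uu i, uu (i + 1)} \<in> (`) f ` MO_U_edges n" by blast
  moreover have "f (uu i) \<in> f ` {uu i, uu (i + 1)}" by blast
  ultimately show "f (uu i) = uu k \<Longrightarrow> (`) f ` MO_U_edges n = MO_U_edges n"
    and "f (uu i) = vv k \<Longrightarrow> (`) f ` MO_U_edges n = MO_V_edges n a b"
    using vv_notin_U_edge uu_notin_V_edge by metis+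
qed

lemma preserving_V_edges:
  assumes f: "preserving f" and vv: "f (vv i) = vv k"
  shows "(`) f ` MO_V_edges n a b = MO_V_edges n a b"
proof -
  have "(`) f ` MO_V_edges n a b = MO_U_edges n \<or> (`) f ` MO_V_edges n a b = MO_V_edges n a b"
    using f preserving_part_not_spokes[OF f, of "MO_V_edges n a b"] by (simp add: preserving_def)
  moreover obtain x where "{vv i, x} \<in> MO_V_edges n a b" unfolding V_edge_iff by metis
  then have "f ` {vv i, x} \<in> (`) f ` MO_V_edges n a b" by blast
  moreover have "f (vv i) \<in> f ` {vv i, x}" by blast
  ultimately show ?thesis
    using vv vv_notin_U_edge by metis
qed

lemma nat_offset: obtains m :: nat where "int n dvd j - (k + int m)"
proof
  show "int n dvd j - (k + int (nat ((j - k) mod int n)))"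
    using n_pos by (simp add: mod_eq_dvd_iff[symmetric] mod_simps)
qed

text \<open>The image of the cycle on U is a walk along the cycle numbered by \<open>c\<close>,
  hence follows \<open>c\<close> in one of two directions. The numbering will be \<open>uu\<close>
  for maps fixing a vertex and the zigzag for maps exchanging the cycles.\<close>

lemma U_walk:
  assumes f: "preserving f" and c: "f (uu k) = c l"
    and nbr: "\<And>j x. {c j, x} \<in> (`) f ` MO_U_edges n \<Longrightarrow> x = c (j + 1) \<or> x = c (j - 1)"
    and per: "\<And>i j. int n dvd i - j \<Longrightarrow> c i = c j"
  shows "(\<forall>i. f (uu i) = c (l + (i - k))) \<or> (\<forall>i. f (uu i) = c (l - (i - k)))"
proof -
  let ?p = "\<lambda>i. f (uu (k + int i))"
  have walk: "(\<forall>i. ?p i = c (l + int i)) \<or> (\<forall>i. ?p i = c (l - int i))"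
  proof (rule nonbacktracking_walk[OF nbr])
    fix i
    have "{uu (k + int i), uu (k + int (Suc i))} \<in> MO_U_edges n"
      by (simp add: U_edge_iff algebra_simps)
    then have "f ` {uu (k + int i), uu (k + int (Suc i))} \<in> (`) f ` MO_U_edges n" by blast
    then show "{?p i, ?p (Suc i)} \<in> (`) f ` MO_U_edges n" by simp
    \<comment> \<open>\<open>f\<close> is injective and \<open>n\<close> does not divide 2.\<close>
    show "?p i \<noteq> ?p (Suc (Suc i))"
      using small_ndvd by (simp add: preserving_eq_iff[OF f])
  next
    show "?p 0 = c l" using c by simp
  qed
  \<comment> \<open>The walk reaches only subscripts \<open>k + int m\<close>; periodicity modulo
    \<open>n\<close> extends the formula to all integers.\<close>
  have step: "f (uu i) = c (l + s * (i - k))"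
    if s: "s = 1 \<or> s = - 1" and p: "\<And>m. ?p m = c (l + s * int m)" for i s
  proof -
    obtain m where m: "int n dvd i - (k + int m)" by (rule nat_offset)
    then have "f (uu i) = f (uu (k + int m))" by (intro arg_cong[of _ _ f]) simp
    also have "\<dots> = c (l + s * int m)" by (rule p)
    also have "(l + s * int m) - (l + s * (i - k)) = - s * (i - (k + int m))"
      by (simp add: algebra_simps)
    then have "c (l + s * int m) = c (l + s * (i - k))"
      using m by (intro per) simp
    finally show ?thesis .
  qed
  from walk show ?thesis
  proof
    assume "\<forall>i. ?p i = c (l + int i)"
    then have "f (uu i) = c (l + 1 * (i - k))" for i
      by (intro step) (simp_all only: mult_1 simp_thms)
    then show ?thesis unfolding mult_1 by blast
  next
    assume "\<forall>i. ?p i = c (l - int i)"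
    then have "f (uu i) = c (l + - 1 * (i - k))" for i
      by (intro step) (simp_all only: mult_minus1 diff_conv_add_uminus simp_thms)
    then show ?thesis unfolding mult_minus1 add_uminus_conv_diff by blast
  qed
qed

lemma preserving_semiregular:
  assumes f: "preserving f" and x: "x \<in> MO_verts n" "f x = x"
  shows "f = (\<lambda>x\<in>MO_verts n. x)"
proof -
  obtain k where "x = uu k \<or> x = vv k" using x unfolding verts_eq by blast
  then have k: "f (uu k) = uu k" "f (vv k) = vv k"
    using x preserving_spoke(1)[OF f, of k k] by auto
  have "(\<forall>i. f (uu i) = uu (k + (i - k))) \<or> (\<forall>i. f (uu i) = uu (k - (i - k)))"
    by (rule U_walk[where c = uu, OF f k(1)]) (simp_all add: preserving_U_edges(1)[OF f k(1)] U_edge_iff)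
  then show ?thesis
  proof
    assume "\<forall>i. f (uu i) = uu (k + (i - k))"
    then have u: "f (uu i) = uu i" for i by simp
    then have v: "f (vv i) = vv i" for i using preserving_spoke(1)[OF f] by blast
    have "f \<in> extensional (MO_verts n)"
      using f by (simp add: preserving_def graph_automorphisms_def Bij_def)
    moreover have "f x = x" if "x \<in> MO_verts n" for x
      using that u v unfolding verts_eq by blast
    ultimately show ?thesis by (intro extensionalityI[of _ "MO_verts n"]) auto
  next
    assume "\<forall>i. f (uu i) = uu (k - (i - k))"
    then have v: "f (vv i) = vv (2 * k - i)" for i
      using preserving_spoke(1)[OF f, of i "2 * k - i"] by (simp add: algebra_simps)
    \<comment> \<open>The reflection about \<open>k\<close> is refuted on the two edges at
      \<open>vv 0\<close>.\<close>
    have edge: "f ` e \<in> MO_V_edges n a b" if "e \<in> MO_V_edges n a b" for e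
      using that preserving_V_edges[OF f k(2)] by blast
    have "{vv 0, vv (int c)} \<in> MO_V_edges n a b" if "c = a \<or> c = b" for c
      using that V_edge_iff[of 0] by auto
    from edge[OF this]
    have "{vv (2 * k), vv (2 * k - int c)} \<in> MO_V_edges n a b" if "c = a \<or> c = b" for c
      using that by (simp add: v)
    then have "vv (2 * k - int c) = vv (2 * k + int a) \<or> vv (2 * k - int c) = vv (2 * k + int b)"
      if "c = a \<or> c = b" for c
      using that by (simp add: V_edge_iff del: vv_eq_iff)
    \<comment> \<open>The mixed coincidences would give \<open>int a + int b\<close> divisible by
      \<open>n\<close>, so each offset must agree with its own negative.\<close>
    from this[of a] this[of b] have "int n dvd - int a - int a" "int n dvd - int b - int b"
      using sum_ndvd by (auto simp: dvd_diff_commute[of _ "- int b"] dvd_diff_commute[of _ "- int a"] add.commute)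
    then have "int n dvd 2 * int a" "int n dvd 2 * int b" by (simp_all add: dvd_diff_commute[of _ "- int b"] dvd_diff_commute[of _ "- int a"])
    moreover obtain m where m: "int n = 2 * m" using even_n by (metis evenE even_of_nat)
    ultimately have "m dvd int a" "m dvd int b" by simp_all
    then obtain s t where st: "int a = m * s" "int b = m * t" by blast
    \<comment> \<open>Odd multiples \<open>a\<close> and \<open>b\<close> of half of
      \<open>n\<close> have a sum divisible by \<open>n\<close>, which is excluded.\<close>
    then have "odd s" "odd t" using odd_a odd_b by (metis even_mult_iff even_of_nat)+
    then obtain r where "s + t = 2 * r" by (metis evenE odd_even_add)
    then have "int a + int b = int n * r"
      using m st by (simp add: distrib_left[symmetric])
    then show ?thesis using sum_ndvd by simp
  qed
qed

section \<open>Transitivity\<close>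

abbreviation "PA \<equiv> partition_automorphisms (MO_verts n) (MO_edges n a b) parts"

lemma preserving_if_PA: "f \<in> PA \<Longrightarrow> preserving f"
  unfolding preserving_def
  by (intro conjI ballI partition_automorphisms_image subsetD[OF partition_automorphisms_subset])

text \<open>Vertices carry natural subscripts below \<open>n\<close>, so maps given by integer
  subscripts are well defined once they are periodic.\<close>

lemma vertex_map_exists:
  assumes "\<And>i j. int n dvd i - j \<Longrightarrow> \<alpha> i = \<alpha> j" "\<And>i j. int n dvd i - j \<Longrightarrow> \<beta> i = \<beta> j"
  obtains f where "f \<in> extensional (MO_verts n)" "\<And>i. f (uu i) = \<alpha> i" "\<And>i. f (vv i) = \<beta> i"
proof
  let ?f = "\<lambda>x\<in>MO_verts n. case x of U i \<Rightarrow> \<alpha> (int i) | V i \<Rightarrow> \<beta> (int i)"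
  have mod_dvd: "int n dvd int (nat (i mod int n)) - i" for i
    using n_pos by (simp add: mod_eq_dvd_iff[symmetric])
  show "?f \<in> extensional (MO_verts n)" by (rule restrict_extensional)
  have "?f (uu i) = \<alpha> (int (nat (i mod int n)))" "?f (vv i) = \<beta> (int (nat (i mod int n)))" for i
    by (simp_all only: restrict_apply' uu_in_verts vv_in_verts)
       (simp_all only: uu_def vv_def MO_vertex.case)
  then show "?f (uu i) = \<alpha> i" "?f (vv i) = \<beta> i" for i
    using assms(1)[OF mod_dvd] assms(2)[OF mod_dvd] by (simp_all only:)
qed

text \<open>An odd \<open>c\<close> exchanges even and odd subscripts, which turns an offset added
  at an even end into one subtracted at an odd end.\<close>

lemma reflection_exists:
  assumes c: "odd c"
  obtains f where "f \<in> PA" "\<And>i. f (uu i) = uu (c - i)" "\<And>i. f (vv i) = vv (c - i)"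
proof -
  obtain f where f: "f \<in> extensional (MO_verts n)"
    "\<And>i. f (uu i) = uu (c - i)" "\<And>i. f (vv i) = vv (c - i)"
    by (rule vertex_map_exists[of "\<lambda>i. uu (c - i)" "\<lambda>i. vv (c - i)"]) (simp_all add: dvd_diff_commute)
  have "f \<in> PA"
  proof (rule involution_in_partition_automorphisms[OF parts_subset edges_eq f(1), where \<sigma> = "\<lambda>P. P"])
    show "f x \<in> MO_verts n" "f (f x) = x" if "x \<in> MO_verts n" for x
      using that by (auto elim!: verts_cases simp: f(2,3) simp del: uu_eq_iff vv_eq_iff)
    fix P e assume P: "P \<in> parts" and e: "e \<in> P"
    then consider "e \<in> MO_U_edges n" "P = MO_U_edges n" | "e \<in> MO_spokes n" "P = MO_spokes n"
      | "e \<in> MO_V_edges n a b" "P = MO_V_edges n a b" by blast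
    then show "f ` e \<in> P"
    proof cases
      case 1
      then obtain i where "e = {uu i, uu (i + 1)}" unfolding U_edges_eq by blast
      then show ?thesis using 1 by (simp add: f U_edge_iff)
    next
      case 2
      then obtain i where "e = {uu i, vv i}" unfolding spokes_eq by blast
      then show ?thesis using 2 by (simp add: f spoke_iff)
    next
      case 3
      then obtain i where "even i" "e = {vv i, vv (i + int a)} \<or> e = {vv i, vv (i + int b)}"
        unfolding V_edges_eq by blast
      then show ?thesis using 3 c by (auto simp: f V_edge_iff)
    qed
  qed simp_all
  then show thesis using that f by blast
qed

section \<open>Exchanging the two cycles\<close>

lemma zigzag_edge_iff:
  "{vv (zigzag (int a) (int b) j), x} \<in> MO_V_edges n a b \<longleftrightarrow>
     x = vv (zigzag (int a) (int b) (j + 1)) \<or> x = vv (zigzag (int a) (int b) (j - 1))"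
proof (cases "even j")
  case True
  then show ?thesis
    using odd_a odd_b by (auto simp: V_edge_iff even_zigzag zigzag_next_even)
next
  case False
  then show ?thesis
    using odd_a odd_b by (auto simp: V_edge_iff even_zigzag zigzag_next_odd)
qed

lemma vv_zigzag_cong: "int n dvd i - j \<Longrightarrow> vv (zigzag (int a) (int b) i) = vv (zigzag (int a) (int b) j)"
  and uu_zigzag_cong: "int n dvd i - j \<Longrightarrow> uu (zigzag (int a) (int b) i) = uu (zigzag (int a) (int b) j)"
  using zigzag_cong[of "int n" "int a" "int b" i j] even_n odd_a odd_b by simp_all

text \<open>The map sends \<open>uu i\<close> to \<open>vv (?z i)\<close> and \<open>vv i\<close> to
  \<open>uu (?z i)\<close>; the assumption says precisely that it is an involution.\<close>

lemma swap_exists: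
  assumes invol: "\<And>i. int n dvd zigzag (int a) (int b) (zigzag (int a) (int b) i) - i"
  shows "\<exists>f\<in>PA. f (uu 0) = vv 0"
proof -
  let ?z = "zigzag (int a) (int b)"
  obtain f where f: "f \<in> extensional (MO_verts n)"
    "\<And>i. f (uu i) = vv (?z i)" "\<And>i. f (vv i) = uu (?z i)"
    by (rule vertex_map_exists[of "\<lambda>i. vv (?z i)" "\<lambda>i. uu (?z i)", OF vv_zigzag_cong uu_zigzag_cong])
       (assumption | rule that)+
  have zz: "vv (?z (?z i)) = vv i" "uu (?z (?z i)) = uu i" for i
    using invol by simp_all
  let ?\<sigma> = "\<lambda>P. if P = MO_U_edges n then MO_V_edges n a b
     else if P = MO_V_edges n a b then MO_U_edges n else P"
  have "{uu 0, vv 0} \<in> MO_spokes n" "{uu 0, uu 1} \<in> MO_U_edges n"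
    by (simp_all add: spoke_iff U_edge_iff)
  then have neq: "MO_U_edges n \<noteq> MO_V_edges n a b" "MO_spokes n \<noteq> MO_U_edges n"
    "MO_spokes n \<noteq> MO_V_edges n a b"
    using vv_notin_U_edge uu_notin_V_edge by blast+
  have "f \<in> PA"
  proof (rule involution_in_partition_automorphisms[OF parts_subset edges_eq f(1), where \<sigma> = ?\<sigma>])
    show "f x \<in> MO_verts n" "f (f x) = x" if "x \<in> MO_verts n" for x
      using that by (auto elim!: verts_cases simp: f zz simp del: uu_eq_iff vv_eq_iff)
    fix P e assume P: "P \<in> parts" and e: "e \<in> P"
    then consider "e \<in> MO_U_edges n" "P = MO_U_edges n" | "e \<in> MO_spokes n" "P = MO_spokes n"
      | "e \<in> MO_V_edges n a b" "P = MO_V_edges n a b" by blast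
    then show "f ` e \<in> ?\<sigma> P"
    proof cases
      case 1
      then obtain i where "e = {uu i, uu (i + 1)}" unfolding U_edges_eq by blast
      then show ?thesis using 1 by (simp add: f zigzag_edge_iff)
    next
      case 2
      then obtain i where "e = {uu i, vv i}" unfolding spokes_eq by blast
      then show ?thesis using 2 neq by (simp add: f spoke_iff)
    next
      case 3
      then obtain i x where ix: "e = {vv i, x}" unfolding V_edges_eq by blast
      \<comment> \<open>Writing \<open>vv i\<close> as the vertex at position \<open>?z i\<close> of
        the zigzag puts its neighbours at the adjacent positions, which \<open>f\<close> returns as
        subscripts on U.\<close>
      then have "{vv (?z (?z i)), x} \<in> MO_V_edges n a b" using 3 by (simp only: zz)
      then have "x = vv (?z (?z i + 1)) \<or> x = vv (?z (?z i - 1))" by (simp only: zigzag_edge_iff)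
      then have "f x = uu (?z i + 1) \<or> f x = uu (?z i - 1)" by (auto simp only: f zz)
      then show ?thesis using 3 neq ix by (auto simp: f U_edge_iff)
    qed
  qed (use neq in auto)
  then show ?thesis using f(2)[of 0] by auto
qed

text \<open>The image of the cycle on U follows the zigzag forwards or backwards. The spokes give
  the same formula on V, so squaring \<open>f\<close> iterates the zigzag.\<close>

lemma swap_involution:
  assumes f: "preserving f" and f0: "f (uu 0) = vv 0" and ff: "\<And>x. x \<in> MO_verts n \<Longrightarrow> f (f x) = x"
  shows "(\<forall>i. int n dvd zigzag (int a) (int b) (zigzag (int a) (int b) i) - i) \<or> (\<forall>i. int n dvd zigzag (int b) (int a) (zigzag (int b) (int a) i) - i)"
proof -
  have "(\<forall>i. f (uu i) = vv (zigzag (int a) (int b) (0 + (i - 0)))) \<or> (\<forall>i. f (uu i) = vv (zigzag (int a) (int b) (0 - (i - 0))))"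
    by (rule U_walk[OF f, where c = "\<lambda>i. vv (zigzag (int a) (int b) i)"])
       (use f0 vv_zigzag_cong in \<open>simp_all only: zigzag_0 preserving_U_edges(2)[OF f f0] zigzag_edge_iff\<close>)
  then have "(\<forall>i. f (uu i) = vv (zigzag (int a) (int b) i)) \<or> (\<forall>i. f (uu i) = vv (zigzag (int b) (int a) i))"
    by (simp add: zigzag_minus)
  moreover have "int n dvd \<pi> (\<pi> i) - i" if "\<And>i. f (uu i) = vv (\<pi> i)" for \<pi> i
  proof -
    have "f (vv j) = uu (\<pi> j)" for j using preserving_spoke(2)[OF f] that by blast
    then have "f (f (uu i)) = uu (\<pi> (\<pi> i))" using that by simp
    then show ?thesis using ff[of "uu i"] uu_eq_iff[of "\<pi> (\<pi> i)" i] by (simp del: uu_eq_iff)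
  qed
  ultimately show ?thesis by blast
qed

lemma PA_subgroup: "subgroup PA (Aut (MO_verts n) (MO_edges n a b))"
  by (rule subgroup_partition_automorphisms[OF parts_subset])

lemma PA_transitive:
  assumes swap: "\<exists>f\<in>PA. f (uu 0) = vv 0" and xy: "x \<in> MO_verts n" "y \<in> MO_verts n"
  shows "\<exists>f\<in>PA. f x = y"
proof -
  define R where "R x y \<longleftrightarrow> (\<exists>f\<in>PA. f x = y)" for x y
  have sym: "R y x" if "R x y" "x \<in> MO_verts n" for x y
  proof -
    from that obtain f where "f \<in> PA" "f x = y" by (auto simp: R_def)
    then show ?thesis
      using subgroup_Aut_inv_closed[OF PA_subgroup] that(2) unfolding R_def by metis
  qed
  have trans: "R x z" if "R x y" "R y z" "x \<in> MO_verts n" for x y z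
  proof -
    from that obtain f g where "f \<in> PA" "f x = y" "g \<in> PA" "g y = z" by (auto simp: R_def)
    then show ?thesis
      using subgroup_Aut_mult_closed[OF PA_subgroup, of g f] that(3) unfolding R_def by metis
  qed
  have reflect: "R (uu (c - i)) (uu i)" "R (vv (c - i)) (vv i)" if c: "odd c" for c i
  proof -
    obtain f where "f \<in> PA" "\<And>i. f (uu i) = uu (c - i)" "\<And>i. f (vv i) = vv (c - i)"
      using reflection_exists[OF c] by blast
    then have "f \<in> PA" "f (uu (c - i)) = uu i" "f (vv (c - i)) = vv i" by simp_all
    then show "R (uu (c - i)) (uu i)" "R (vv (c - i)) (vv i)" unfolding R_def by blast+
  qed
  \<comment> \<open>The reflection with \<open>c = i\<close> exchanges 0 and \<open>i\<close>. An
    even \<open>i\<close> is then reached from 1 with \<open>c = i + 1\<close>.\<close>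
  have odd: "R (uu 0) (uu i)" "R (vv 0) (vv i)" if "odd i" for i
    using reflect[of i i] that by simp_all
  have "R (uu 1) (uu i)" "R (vv 1) (vv i)" if "even i" for i
    using reflect[of "i + 1" i] that by (simp_all add: add.commute)
  then have even: "R (uu 0) (uu i)" "R (vv 0) (vv i)" if "even i" for i
    using trans[OF odd(1)[of 1]] trans[OF odd(2)[of 1]] that by simp_all
  have "R (uu 0) (vv 0)" using swap by (simp add: R_def)
  then have "R (uu 0) (uu i)" "R (uu 0) (vv i)" for i
    using odd[of i] even[of i] trans[of "uu 0" "vv 0" "vv i"] by auto
  then have "R (uu 0) z" if "z \<in> MO_verts n" for z
    using that by (auto elim: verts_cases)
  then have "R x y" using xy sym trans uu_in_verts by metis
  then show ?thesis by (simp add: R_def)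
qed

text \<open>Forwards, a member taking \<open>uu 0\<close> to \<open>vv 0\<close> reverses that
  spoke, so its square fixes \<open>uu 0\<close> and is trivial by regularity. Backwards,
  \<open>PA\<close> itself is regular.\<close>

lemma regular_subgroup_iff:
  "(\<exists>G. subgroup G (Aut (MO_verts n) (MO_edges n a b)) \<and>
      regular_action ((Aut (MO_verts n) (MO_edges n a b))\<lparr>carrier := G\<rparr>) (MO_verts n) (\<lambda>f. f) \<and>
      preserves_edge_partition G parts) \<longleftrightarrow>
   (\<forall>i. int n dvd zigzag (int a) (int b) (zigzag (int a) (int b) i) - i) \<or>
   (\<forall>i. int n dvd zigzag (int b) (int a) (zigzag (int b) (int a) i) - i)"
  (is "?L \<longleftrightarrow> ?ab \<or> ?ba")
proof
  assume ?L
  then obtain G where G: "subgroup G (Aut (MO_verts n) (MO_edges n a b))"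
    and reg: "regular_action ((Aut (MO_verts n) (MO_edges n a b))\<lparr>carrier := G\<rparr>) (MO_verts n) (\<lambda>f. f)"
    and part: "preserves_edge_partition G parts" by blast
  note reg' = reg[unfolded regular_action_iff[OF G]]
  obtain f where fG: "f \<in> G" and f0: "f (uu 0) = vv 0"
    using reg' uu_in_verts vv_in_verts by blast
  have f: "preserving f"
    using subgroup.subset[OF G] fG part
    by (auto simp: preserving_def Aut_def preserves_edge_partition_def)
  obtain h where h: "h \<in> G" "\<And>x. x \<in> MO_verts n \<Longrightarrow> h x = f (f x)"
    using subgroup_Aut_mult_closed[OF G fG fG] by blast
  have "h (uu 0) = uu 0"
    using h(2)[of "uu 0"] f0 preserving_spoke(2)[OF f, of 0 0] by simp
  then have "h = (\<lambda>x\<in>MO_verts n. x)"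
    using reg' h(1) uu_in_verts by blast
  then have "f (f x) = x" if "x \<in> MO_verts n" for x
    using h(2)[OF that] that by simp
  then show "?ab \<or> ?ba" by (rule swap_involution[OF f f0])
next
  assume "?ab \<or> ?ba"
  \<comment> \<open>Exchanging \<open>a\<close> and \<open>b\<close> leaves the graph unchanged, so
    the second alternative is the first one for the exchanged parameters.\<close>
  moreover have "MO_V_edges n b a = MO_V_edges n a b" by (auto simp: MO_V_edges_def)
  then have "\<exists>f\<in>PA. f (uu 0) = vv 0" if ?ba
    using honeycomb.swap_exists[OF swap_params] that by (simp add: MO_edges_def)
  ultimately have swap: "\<exists>f\<in>PA. f (uu 0) = vv 0"
    using swap_exists by blast
  have "preserves_edge_partition PA parts"
    unfolding preserves_edge_partition_def
    using preserving_if_PA[unfolded preserving_def] by simp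
  moreover have "regular_action ((Aut (MO_verts n) (MO_edges n a b))\<lparr>carrier := PA\<rparr>) (MO_verts n) (\<lambda>f. f)"
    unfolding regular_action_iff[OF PA_subgroup]
    using PA_transitive[OF swap] preserving_semiregular preserving_if_PA by blast
  ultimately show ?L using PA_subgroup by blast
qed

end

theorem theorem4p3:
  fixes n a b :: nat
  assumes "n \<ge> 4" and "even n"
    and "odd a" and "odd b" and "0 < a" and "a < b" and "b < n"
    and "gcd (b - a) n = 2" and "a \<noteq> n - b"
  shows "(\<exists>G. subgroup G (Aut (MO_verts n) (MO_edges n a b)) \<and>
             regular_action ((Aut (MO_verts n) (MO_edges n a b))\<lparr>carrier := G\<rparr>)
               (MO_verts n) (\<lambda>f. f) \<and>
             preserves_edge_partition G {MO_U_edges n, MO_V_edges n a b, MO_spokes n})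
     \<longleftrightarrow>
         [(int b - int a)^2 div 2 = 2] (mod int n) \<and>
         ([int a + (int a - 1) * (int a - int b) div 2 = 1] (mod int n) \<or>
          [int b + (int b - 1) * (int b - int a) div 2 = 1] (mod int n))"
proof -
  have "\<not> int n dvd int a - int b"
    using zdvd_imp_le[of "int n" "int b - int a"] assms by (auto simp: dvd_diff_commute[of _ "int a"])
  moreover have "\<not> int n dvd int a + int b"
  proof
    assume "int n dvd int a + int b"
    then obtain k where k: "int a + int b = int n * k" by blast
    \<comment> \<open>The sum lies strictly between 0 and \<open>2 * n\<close>, so it could only be
      \<open>n\<close>, contrary to \<open>a \<noteq> n - b\<close>.\<close>
    have "0 < int n * k" "int n * k < int n * 2" using assms k by linarith+
    then have "0 < k" "k < 2" using assms by (simp_all add: zero_less_mult_iff)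
    then have "k = 1" by simp
    then show False using k assms by simp
  qed
  ultimately interpret honeycomb n a b
    by (intro honeycomb.intro assms(1-4))
  have odd: "odd (int a)" "odd (int b)" using assms(3,4) by simp_all
  \<comment> \<open>The square is the same for both orders of the parameters, so its congruence
    factors out of the disjunction.\<close>
  show ?thesis
    unfolding regular_subgroup_iff zigzag_involution_iff[OF odd]
      zigzag_involution_iff[OF odd(2,1)] power2_commute[of "int a" "int b"]
    by blast
qed

end
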